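(* Let $\theta_0$ be an interior point of $\Theta$. Let $g\in\mathcal{G}(\mathbb{R},\theta_0)$, let $Z_\theta$ be distributed according to $g(\cdot;\theta)$, and let $X$ be a random variable taking values in $\mathbb{R}$. Then the following two assertions hold. (1) If $X\stackrel{\mathcal{D}}{=}Z_{\theta_0}$, then $\mathrm{E}[\mathcal{T}_{\theta_0}(f,g)(X)]=0$ for all $f\in\mathcal{F}(g;\theta_0)$. (2) If the support $S_\theta=:S$ of $g(\cdot;\theta)$ does not depend on $\theta$ and if $\mathrm{E}[\mathcal{T}_{\theta_0}(f,g)(X)]=0$ for all $f\in\mathcal{F}(g;\theta_0)$, then $X\,|\,X\in S\stackrel{\mathcal{D}}{=}Z_{\theta_0}$ (the conditional law of $X$ given $X\in S$ is the law of $Z_{\theta_0}$).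
   Context: $\Theta\subseteq\mathbb{R}$ is a non-empty set and $\mu$ is a $\sigma$-finite dominating measure on $\mathbb{R}$. A measurable function $g:\mathbb{R}\times\Theta\to\mathbb{R}^+$ is a family of $\theta$-parametric densities if $\int g(x;\theta)\,d\mu(x)=1$ for all $\theta\in\Theta$. For $\theta_0\in\Theta$, $\mathcal{G}(\mathbb{R},\theta_0)$ is the collection of $\theta$-parametric densities $g$ for which there exist a bounded neighborhood $\Theta_0\subset\Theta$ of $\theta_0$ and a $\mu$-integrable function $h:\mathbb{R}\to\mathbb{R}^+$ such that $g(x;\theta)\le h(x)$ for all $x\in\mathbb{R}$ and $\theta\in\Theta_0$. The support of $g(\cdot;\theta)$ is $S_\theta=\{x\in\mathbb{R}: g(x;\theta)>0\}$. "Distributed according to $g(\cdot;\theta)$" means having density $g(\cdot;\theta)$ with respect to $\mu$; $\stackrel{\mathcal{D}}{=}$ is equality in law. For $\theta_0$ an interior point of $\Theta$ and $g\in\mathcal{G}(\mathbb{R},\theta_0)$, the class $\mathcal{F}(g;\theta_0)$ is the collection of functions $f:\mathbb{R}\times\Theta\to\mathbb{R}$ such that there exists a neighborhood $\Theta_0$ of $\theta_0$ where the following hold: (i) there is a constant $c_f\in\mathbb{R}$ (not depending on $\theta$) such that $\int f(x;\theta)g(x;\theta)\,d\mu(x)=c_f$ for all $\theta\in\Theta_0$; (ii) for all $x\in S_\theta$ the mapping $\theta\mapsto f(x;\theta)g(x;\theta)$ is differentiable in the sense of distributions over $\Theta_0$; (iii) there exists a ($\mu$-)integrable function $h:\mathbb{R}\to\mathbb{R}^+$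 such that for all $\theta\in\Theta_0$, $|\partial_\theta(f(x;\theta)g(x;\theta))|\le h(x)$ over $\mathbb{R}$. The Stein operator $\mathcal{T}_{\theta_0}(\cdot,g)$ is defined on $\mathcal{F}(g;\theta_0)$ by $$\mathcal{T}_{\theta_0}(f,g)(x)=\frac{\partial_\theta(f(x;\theta)g(x;\theta))|_{\theta=\theta_0}}{g(x;\theta_0)},$$ with the convention that $1/g(x;\theta_0)=0$ outside the support $S_{\theta_0}$.
   Formalization: In (1), f must also satisfy ∂θ(fg)|θ0 = 0 for μ-almost every x outside S_θ0 (otherwise (1) is false); members f of F are jointly measurable with fg classically differentiable at θ0 for every x in S_θ0; (2) assumes P(X∈S) > 0. *)

theory Defs
  imports "HOL-Probability.Probability"
begin

section \<open>Distributional derivatives on the real line\<close>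

text \<open>Smoothness and support are conditions on the whole line, so that a test function on \<open>U\<close>
  is already extended by zero outside \<open>U\<close>.\<close>

definition test_function_on :: "real set \<Rightarrow> (real \<Rightarrow> real) \<Rightarrow> bool" where
  "test_function_on U \<phi> \<longleftrightarrow>
     (\<forall>k t. (deriv ^^ k) \<phi> differentiable (at t)) \<and>
     compact (closure {t. \<phi> t \<noteq> 0}) \<and> closure {t. \<phi> t \<noteq> 0} \<subseteq> U"

definition locally_integrable_on :: "real set \<Rightarrow> (real \<Rightarrow> real) \<Rightarrow> bool" where
  "locally_integrable_on U u \<longleftrightarrow> (\<forall>K. compact K \<and> K \<subseteq> U \<longrightarrow> set_integrable lborel K u)"

text \<open>Every locally integrable \<open>u\<close> has a derivative in the space of distributions; the content of
  the following notion is that this derivative is (the regular distribution given by) the function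
  \<open>D\<close>, as it has to be for a pointwise bound on it to make sense.\<close>

definition has_distributional_derivative_on ::
    "(real \<Rightarrow> real) \<Rightarrow> (real \<Rightarrow> real) \<Rightarrow> real set \<Rightarrow> bool" where
  "has_distributional_derivative_on u D U \<longleftrightarrow>
     locally_integrable_on U u \<and> locally_integrable_on U D \<and>
     (\<forall>\<phi>. test_function_on U \<phi> \<longrightarrow>
        (LINT t:U|lborel. u t * deriv \<phi> t) = - (LINT t:U|lborel. D t * \<phi> t))"


section \<open>Parametric densities\<close>

definition parametric_densities :: "real measure \<Rightarrow> real set \<Rightarrow> (real \<Rightarrow> real \<Rightarrow> real) set" where
  "parametric_densities \<mu> \<Theta> =
     {g. (\<lambda>(x, \<theta>). g x \<theta>) \<in> borel_measurable (borel \<Otimes>\<^sub>M restrict_space borel \<Theta>) \<and>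
         (\<forall>x. \<forall>\<theta>\<in>\<Theta>. 0 \<le> g x \<theta>) \<and>
         (\<forall>\<theta>\<in>\<Theta>. has_bochner_integral \<mu> (\<lambda>x. g x \<theta>) 1)}"

definition dominated_densities ::
    "real measure \<Rightarrow> real set \<Rightarrow> real \<Rightarrow> (real \<Rightarrow> real \<Rightarrow> real) set" where
  "dominated_densities \<mu> \<Theta> \<theta>\<^sub>0 =
     {g \<in> parametric_densities \<mu> \<Theta>.
        \<exists>\<Theta>\<^sub>0 h. bounded \<Theta>\<^sub>0 \<and> \<theta>\<^sub>0 \<in> interior \<Theta>\<^sub>0 \<and> \<Theta>\<^sub>0 \<subseteq> \<Theta> \<and>
          integrable \<mu> h \<and> (\<forall>x. 0 \<le> h x) \<and> (\<forall>x. \<forall>\<theta>\<in>\<Theta>\<^sub>0. g x \<theta> \<le> h x)}"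

definition density_support :: "(real \<Rightarrow> real \<Rightarrow> real) \<Rightarrow> real \<Rightarrow> real set" where
  "density_support g \<theta> = {x. 0 < g x \<theta>}"


section \<open>Stein class and Stein operator\<close>

text \<open>A distributional derivative is determined only almost everywhere, whereas the Stein operator
  evaluates \<open>\<partial>\<^sub>\<theta> (f g)\<close> at the single point \<open>\<theta>\<^sub>0\<close>.  The value there is the classical derivative,
  and its existence on the support of \<open>g(\<cdot>; \<theta>\<^sub>0)\<close>, the only place where the Stein operator uses
  it, is part of the class.  Members are jointly measurable, like \<open>g\<close>.  Conditions on a neighbourhood of \<open>\<theta>\<^sub>0\<close> are inherited by smaller
  neighbourhoods, so taking it open is no restriction; \<open>D x \<theta>\<close> stands for
  \<open>\<partial>\<^sub>\<theta> (f(x; \<theta>) g(x; \<theta>))\<close>.\<close>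

definition stein_class ::
    "real measure \<Rightarrow> real set \<Rightarrow> (real \<Rightarrow> real \<Rightarrow> real) \<Rightarrow> real \<Rightarrow> (real \<Rightarrow> real \<Rightarrow> real) set" where
  "stein_class \<mu> \<Theta> g \<theta>\<^sub>0 =
     {f. (\<lambda>(x, \<theta>). f x \<theta>) \<in> borel_measurable (borel \<Otimes>\<^sub>M restrict_space borel \<Theta>) \<and>
         (\<exists>\<Theta>\<^sub>0. open \<Theta>\<^sub>0 \<and> \<theta>\<^sub>0 \<in> \<Theta>\<^sub>0 \<and> \<Theta>\<^sub>0 \<subseteq> \<Theta> \<and>
            (\<exists>c. \<forall>\<theta>\<in>\<Theta>\<^sub>0. has_bochner_integral \<mu> (\<lambda>x. f x \<theta> * g x \<theta>) c) \<and>
            (\<exists>D h.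
               (\<forall>\<theta>\<in>\<Theta>\<^sub>0. \<forall>x\<in>density_support g \<theta>.
                  has_distributional_derivative_on (\<lambda>\<theta>. f x \<theta> * g x \<theta>) (D x) \<Theta>\<^sub>0) \<and>
               integrable \<mu> h \<and> (\<forall>x. 0 \<le> h x) \<and> (\<forall>\<theta>\<in>\<Theta>\<^sub>0. \<forall>x. \<bar>D x \<theta>\<bar> \<le> h x))) \<and>
         (\<forall>x\<in>density_support g \<theta>\<^sub>0. (\<lambda>\<theta>. f x \<theta> * g x \<theta>) differentiable (at \<theta>\<^sub>0))}"

text \<open>The convention that \<open>1 / g(x; \<theta>\<^sub>0)\<close> is \<open>0\<close> off the support is division by zero in HOL.\<close>

definition stein_operator ::
    "real \<Rightarrow> (real \<Rightarrow> real \<Rightarrow> real) \<Rightarrow> (real \<Rightarrow> real \<Rightarrow> real) \<Rightarrow> real \<Rightarrow> real" where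
  "stein_operator \<theta>\<^sub>0 f g x = deriv (\<lambda>\<theta>. f x \<theta> * g x \<theta>) \<theta>\<^sub>0 / g x \<theta>\<^sub>0"

end

theory Submission
  imports Defs "HOL-Computational_Algebra.Polynomial"
begin

text \<open>On the support of \<open>g(\<cdot>; \<theta>\<^sub>0)\<close>, the product of \<open>g(x; \<theta>\<^sub>0)\<close> and \<open>\<T>(f, g)(x)\<close> is
  \<open>\<partial>\<^sub>\<theta> (f(x; \<theta>) g(x; \<theta>))\<close> at \<open>\<theta>\<^sub>0\<close>; off the support the product is \<open>0\<close>, and so is the derivative
  \<open>\<mu>\<close>-almost everywhere, by hypothesis.  The expectation of \<open>\<T>(f, g)\<close> under \<open>g(\<cdot>; \<theta>\<^sub>0)\<close> is therefore the integral of that derivative, and it vanishes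
  because \<open>\<integral> f g d\<mu>\<close> does not depend on \<open>\<theta>\<close>, provided that differentiation and integration can be
  exchanged.

  The exchange is the analytic part of the proof.  The integrable bound \<open>h\<close> controls only the
  distributional derivative of \<open>\<theta> \<mapsto> f(x; \<theta>) g(x; \<theta>)\<close>, while the operator uses the classical derivative at
  the single point \<open>\<theta>\<^sub>0\<close>.  The link is \<open>distributional_derivative_bounded_AE_Lipschitz\<close>: a function
  that is continuous at \<open>c\<close> and whose distributional derivative is bounded by \<open>C\<close> satisfies
  \<open>\<bar>u(t) - u(c)\<bar> \<le> C (t - c)\<close> for almost every \<open>t > c\<close> nearby.  It follows by testing against primitives
  of differences of translated cutoffs and by Lebesgue's differentiation theorem.  Fubini's theorem
  then provides parameters \<open>\<theta>\<^sub>n\<close> tending to \<open>\<theta>\<^sub>0\<close> along which the difference quotients are dominated by \<open>h\<close>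
  for \<open>\<mu>\<close>-almost every \<open>x\<close> (\<open>has_bochner_integral_parameter_derivative_0\<close>), and dominated convergence
  gives \<open>stein_identity\<close>.

  For the converse, the Stein class is rich enough: for every bounded Borel function \<open>l\<close> centred under
  \<open>g(\<cdot>; \<theta>\<^sub>0)\<close>, it contains an \<open>f\<close> with \<open>\<T>(f, g) = l\<close> on the support \<open>S\<close>
  (\<open>linear_perturbation_in_stein_class\<close>).  For a Borel set \<open>A\<close> and \<open>l = 1\<^sub>A - P(Z \<in> A)\<close>, where \<open>Z\<close> has
  density \<open>g(\<cdot>; \<theta>\<^sub>0)\<close>, the vanishing expectation reads \<open>P(X \<in> A \<inter> S) = P(Z \<in> A) P(X \<in> S)\<close>.\<close>

section \<open>Smooth cutoffs as test functions\<close>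

lemma poly_times_exp_minus_tendsto_0:
  fixes p :: "real poly"
  shows "((\<lambda>y. poly p y * exp (- y)) \<longlongrightarrow> 0) at_top"
proof -
  have "((\<lambda>y. \<Sum>i\<le>degree p. coeff p i * (y ^ i / exp y)) \<longlongrightarrow> (\<Sum>i\<le>degree p. coeff p i * 0)) at_top"
    by (intro tendsto_sum tendsto_mult tendsto_const tendsto_power_div_exp_0)
  then show ?thesis
    by (simp add: poly_altdef sum_distrib_right exp_minus divide_inverse mult.assoc)
qed

text \<open>The functions \<open>p(1/x) exp(-1/x)\<close>, extended by \<open>0\<close> to \<open>x \<le> 0\<close>.  The polynomial factor is
there to make the family closed under differentiation, which turns smoothness into an induction.\<close>

definition flat_exp :: "real poly \<Rightarrow> real \<Rightarrow> real" where
  "flat_exp p x = (if 0 < x then poly p (1 / x) * exp (- 1 / x) else 0)"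

lemma flat_exp_has_real_derivative:
  "(flat_exp p has_real_derivative flat_exp ([:0, 0, 1:] * (p - pderiv p)) x) (at x)"
proof -
  consider "x > 0" | "x < 0" | "x = 0" by linarith
  then show ?thesis
  proof cases
    case 1
    have "((\<lambda>x. poly p (1 / x) * exp (- 1 / x)) has_real_derivative
        flat_exp ([:0, 0, 1:] * (p - pderiv p)) x) (at x)"
      using 1 by (auto intro!: derivative_eq_intros
        simp: flat_exp_def field_simps power2_eq_square)
    then show ?thesis
      by (rule has_field_derivative_transform_within_open[where S = "{0<..}"])
        (use 1 in \<open>auto simp: flat_exp_def\<close>)
  next
    case 2
    have "((\<lambda>x. 0) has_real_derivative flat_exp ([:0, 0, 1:] * (p - pderiv p)) x) (at x)"
      using 2 by (auto simp: flat_exp_def)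
    then show ?thesis
      by (rule has_field_derivative_transform_within_open[where S = "{..<0}"])
        (use 2 in \<open>auto simp: flat_exp_def\<close>)
  next
    case 3
    \<comment> \<open>At the origin only the difference quotient from the right matters; in the variable \<open>y = 1/h\<close> it is
      a polynomial times \<open>exp(-y)\<close>.\<close>
    have "((\<lambda>y. flat_exp p (inverse y) / inverse y) \<longlongrightarrow> 0) at_top"
    proof (rule Lim_transform_eventually)
      show "((\<lambda>y. poly (pCons 0 p) y * exp (- y)) \<longlongrightarrow> 0) at_top"
        by (rule poly_times_exp_minus_tendsto_0)
      show "\<forall>\<^sub>F y in at_top. poly (pCons 0 p) y * exp (- y) = flat_exp p (inverse y) / inverse y"
        using eventually_gt_at_top[of 0]
        by eventually_elim (auto simp: flat_exp_def field_simps)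
    qed
    then have "((\<lambda>h. flat_exp p h / h) \<longlongrightarrow> 0) (at_right 0)"
      by (simp add: filterlim_at_right_to_top)
    moreover have "((\<lambda>h. flat_exp p h / h) \<longlongrightarrow> 0) (at_left 0)"
      by (rule tendsto_eventually) (auto simp: flat_exp_def eventually_at intro!: exI[of _ 1])
    ultimately have "((\<lambda>h. flat_exp p h / h) \<longlongrightarrow> 0) (at 0)"
      by (rule filterlim_split_at[rotated])
    then show ?thesis
      using 3 by (simp add: DERIV_def flat_exp_def)
  qed
qed

text \<open>Products of flat functions facing each other vanish outside an interval.  Instead of general
closure properties of smooth functions, it is enough to have one class of functions that contains
these products and, by the product rule, the derivative of each of its members.\<close>

inductive flat_exp_algebra :: "(real \<Rightarrow> real) \<Rightarrow> bool" where
  base: "flat_exp_algebra (\<lambda>t. flat_exp p (m * t + b))"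
| add: "flat_exp_algebra f \<Longrightarrow> flat_exp_algebra g \<Longrightarrow> flat_exp_algebra (\<lambda>t. f t + g t)"
| mult: "flat_exp_algebra f \<Longrightarrow> flat_exp_algebra g \<Longrightarrow> flat_exp_algebra (\<lambda>t. f t * g t)"

lemma flat_exp_algebra_closed_derivative:
  assumes "flat_exp_algebra f"
  shows "\<exists>f'. flat_exp_algebra f' \<and> (\<forall>t. (f has_real_derivative f' t) (at t))"
  using assms
proof induction
  case (base p m b)
  let ?q = "smult m ([:0, 0, 1:] * (p - pderiv p))"
  have "((\<lambda>t. flat_exp p (m * t + b)) has_real_derivative flat_exp ?q (m * t + b)) (at t)" for t
  proof -
    have "((\<lambda>t. flat_exp p (m * t + b)) has_real_derivative
        flat_exp ([:0, 0, 1:] * (p - pderiv p)) (m * t + b) * m) (at t)"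
      by (rule DERIV_chain2[OF flat_exp_has_real_derivative]) (auto intro!: derivative_eq_intros)
    then show ?thesis
      by (simp add: flat_exp_def mult_ac split: if_splits)
  qed
  then show ?case
    using flat_exp_algebra.base by blast
next
  case (add f g)
  then obtain f' g' where *: "flat_exp_algebra f'" "flat_exp_algebra g'"
    "\<And>t. (f has_real_derivative f' t) (at t)" "\<And>t. (g has_real_derivative g' t) (at t)"
    by blast
  then show ?case
    by (intro exI[of _ "\<lambda>t. f' t + g' t"]) (auto intro: flat_exp_algebra.add DERIV_add)
next
  case (mult f g)
  then obtain f' g' where *: "flat_exp_algebra f'" "flat_exp_algebra g'"
    "\<And>t. (f has_real_derivative f' t) (at t)" "\<And>t. (g has_real_derivative g' t) (at t)"
    by blast
  have "flat_exp_algebra (\<lambda>t. f' t * g t + g' t * f t)"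
    by (intro flat_exp_algebra.intros * mult.hyps)
  moreover have "((\<lambda>t. f t * g t) has_real_derivative f' t * g t + g' t * f t) (at t)" for t
    by (rule DERIV_mult[OF *(3,4)])
  ultimately show ?case
    by (intro exI[of _ "\<lambda>t. f' t * g t + g' t * f t"]) blast
qed

lemma flat_exp_algebra_smooth:
  assumes "flat_exp_algebra f"
  shows "(deriv ^^ k) f differentiable (at t)"
proof -
  have "flat_exp_algebra ((deriv ^^ k) f)"
  proof (induction k)
    case (Suc k)
    then obtain f' where "flat_exp_algebra f'"
      "\<And>t. ((deriv ^^ k) f has_real_derivative f' t) (at t)"
      using flat_exp_algebra_closed_derivative by blast
    moreover from this have "deriv ((deriv ^^ k) f) = f'"
      by (auto intro: DERIV_imp_deriv)
    ultimately show ?case by simp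
  qed (use assms in simp)
  then show ?thesis
    using flat_exp_algebra_closed_derivative real_differentiable_def by blast
qed

text \<open>The factors vanish for \<open>t \<le> 0\<close> and for \<open>t \<ge> \<delta>\<close>, respectively.  Since \<open>exp(-1/(k s))\<close> tends to \<open>1\<close> for every
\<open>s > 0\<close>, letting \<open>k\<close> grow makes the product an indicator function.  The arguments are written as
affine functions of \<open>t\<close> to match the generators of \<open>flat_exp_algebra\<close>.\<close>

definition smooth_cutoff :: "nat \<Rightarrow> real \<Rightarrow> real \<Rightarrow> real" where
  "smooth_cutoff k \<delta> t = flat_exp 1 (real k * t + 0) * flat_exp 1 (- real k * t + real k * \<delta>)"

lemma flat_exp_1_bounds: "0 \<le> flat_exp 1 x" "flat_exp 1 x \<le> 1"
  by (auto simp: flat_exp_def)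

lemma smooth_cutoff_bounds: "0 \<le> smooth_cutoff k \<delta> t" "smooth_cutoff k \<delta> t \<le> 1"
  by (auto simp: smooth_cutoff_def flat_exp_1_bounds mult_le_one)

lemma smooth_cutoff_eq_0: "t \<notin> {0<..<\<delta>} \<Longrightarrow> smooth_cutoff k \<delta> t = 0"
  by (auto simp: smooth_cutoff_def flat_exp_def zero_less_mult_iff right_diff_distrib[symmetric]
      not_less)

lemma smooth_cutoff_tendsto: "(\<lambda>k. smooth_cutoff k \<delta> t) \<longlonglongrightarrow> indicator {0<..<\<delta>} t"
proof (cases "t \<in> {0<..<\<delta>}")
  case True
  have one: "(\<lambda>k. flat_exp 1 (real k * s)) \<longlonglongrightarrow> 1" if "s > 0" for s
  proof (rule Lim_transform_eventually)
    have "(\<lambda>k. exp (- (1 / s) * inverse (real k))) \<longlonglongrightarrow> exp (- (1 / s) * 0)"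
      by (intro tendsto_intros lim_inverse_n)
    then show "(\<lambda>k. exp (- (1 / s) * inverse (real k))) \<longlonglongrightarrow> 1" by simp
    show "\<forall>\<^sub>F k in sequentially. exp (- (1 / s) * inverse (real k)) = flat_exp 1 (real k * s)"
      using eventually_gt_at_top[of 0]
      by eventually_elim (use that in \<open>auto simp: flat_exp_def field_simps\<close>)
  qed
  have "(\<lambda>k. flat_exp 1 (real k * t) * flat_exp 1 (real k * (\<delta> - t))) \<longlonglongrightarrow> 1 * 1"
    using True by (intro tendsto_mult one) auto
  then show ?thesis
    using True by (simp add: smooth_cutoff_def algebra_simps)
next
  case False
  then show ?thesis by (simp add: smooth_cutoff_eq_0)
qed

lemma flat_exp_algebra_translate:
  assumes "flat_exp_algebra f"
  shows "flat_exp_algebra (\<lambda>t. f (t - c))"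
  using assms
proof induction
  case (base p m b)
  then show ?case
    using flat_exp_algebra.base[of p m "b - m * c"] by (simp add: algebra_simps)
qed (rule flat_exp_algebra.intros; assumption)+

lemma flat_exp_algebra_scale:
  assumes "flat_exp_algebra f"
  shows "flat_exp_algebra (\<lambda>t. a * f t)"
  using assms
proof induction
  case (base p m b)
  have "a * flat_exp p x = flat_exp (smult a p) x" for x
    by (simp add: flat_exp_def)
  then show ?case
    using flat_exp_algebra.base[of "smult a p" m b] by simp
next
  case (add f g)
  then show ?case
    using flat_exp_algebra.add[of "\<lambda>t. a * f t" "\<lambda>t. a * g t"] by (simp add: algebra_simps)
next
  case (mult f g)
  then show ?case
    using flat_exp_algebra.mult[of "\<lambda>t. a * f t" g] by (simp add: algebra_simps)
qed

lemma flat_exp_algebra_smooth_cutoff: "flat_exp_algebra (smooth_cutoff k \<delta>)"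
  unfolding smooth_cutoff_def by (intro flat_exp_algebra.intros)

lemma isCont_smooth_cutoff: "isCont (smooth_cutoff k \<delta>) t"
  using flat_exp_algebra_smooth[OF flat_exp_algebra_smooth_cutoff, of 0]
  by (simp add: differentiable_imp_continuous_within)

lemma smooth_cutoff_measurable [measurable]: "smooth_cutoff k \<delta> \<in> borel_measurable borel"
  by (simp add: borel_measurable_continuous_onI continuous_at_imp_continuous_on isCont_smooth_cutoff)

text \<open>The difference of two translates of a cutoff has total integral \<open>0\<close>, so it has a primitive with
compact support.  This primitive is \<open>\<Phi>(t - c) - \<Phi>(t - d)\<close> with \<open>\<Phi>\<close> a primitive of the cutoff itself:
\<open>\<Phi>\<close> is nondecreasing and constant outside \<open>[0, \<delta>]\<close>, and it increases by at most \<open>\<delta>\<close> because the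
cutoff is at most \<open>1\<close>.\<close>

lemma test_function_translated_cutoffs:
  fixes c d \<delta> :: real
  assumes "c < d" "0 < \<delta>" "{c..d + \<delta>} \<subseteq> U"
  obtains \<phi> where "test_function_on U \<phi>"
    "deriv \<phi> = (\<lambda>t. smooth_cutoff k \<delta> (t - c) - smooth_cutoff k \<delta> (t - d))"
    "\<And>t. \<bar>\<phi> t\<bar> \<le> \<delta> * indicator {c..d + \<delta>} t"
proof -
  let ?\<sigma> = "smooth_cutoff k \<delta>"
  obtain \<Phi> where \<Phi>: "\<And>t. (\<Phi> has_real_derivative ?\<sigma> t) (at t)"
    using einterval_antiderivative[of "-\<infinity>" "\<infinity>" ?\<sigma>] isCont_smooth_cutoff
    by (auto simp: has_real_derivative_iff_has_vector_derivative)
  have mono: "\<Phi> s \<le> \<Phi> t" if "s \<le> t" for s t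
    using DERIV_nonneg_imp_nondecreasing[OF that, of \<Phi>] \<Phi> smooth_cutoff_bounds(1) by blast
  have left: "\<Phi> t = \<Phi> 0" if "t \<le> 0" for t
  proof (cases "t < 0")
    case True
    then obtain z where "t < z" "z < 0" "\<Phi> 0 - \<Phi> t = (0 - t) * ?\<sigma> z"
      using MVT2[of t 0 \<Phi> ?\<sigma>] \<Phi> by blast
    then show ?thesis by (simp add: smooth_cutoff_eq_0)
  qed (use that in auto)
  have right: "\<Phi> t = \<Phi> \<delta>" if "\<delta> \<le> t" for t
  proof (cases "\<delta> < t")
    case True
    then obtain z where "\<delta> < z" "z < t" "\<Phi> t - \<Phi> \<delta> = (t - \<delta>) * ?\<sigma> z"
      using MVT2[of \<delta> t \<Phi> ?\<sigma>] \<Phi> by blast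
    then show ?thesis by (simp add: smooth_cutoff_eq_0)
  qed (use that in auto)
  obtain z where z: "\<Phi> \<delta> - \<Phi> 0 = (\<delta> - 0) * ?\<sigma> z"
    using MVT2[of 0 \<delta> \<Phi> ?\<sigma>] \<Phi> assms(2) by blast
  have height: "\<Phi> \<delta> - \<Phi> 0 \<le> \<delta>"
    unfolding z using mult_left_mono[OF smooth_cutoff_bounds(2)[of k \<delta> z], of \<delta>] assms(2) by simp
  have lo: "\<Phi> 0 \<le> \<Phi> t" for t
    using mono[of 0 t] left[of t] by linarith
  have hi: "\<Phi> t \<le> \<Phi> \<delta>" for t
    using mono[of t \<delta>] right[of t] by linarith
  define \<phi> where "\<phi> = (\<lambda>t. \<Phi> (t - c) - \<Phi> (t - d))"
  define \<psi> where "\<psi> = (\<lambda>t. ?\<sigma> (t - c) + (-1) * ?\<sigma> (t - d))"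
  have D\<phi>: "(\<phi> has_real_derivative \<psi> t) (at t)" for t
    unfolding \<phi>_def \<psi>_def
    by (auto intro!: derivative_eq_intros DERIV_chain2[OF \<Phi>])
  then have deriv: "deriv \<phi> = \<psi>"
    by (auto intro: DERIV_imp_deriv)
  have zero: "\<phi> t = 0" if "t \<notin> {c..d + \<delta>}" for t
    using that assms left[of "t - c"] left[of "t - d"] right[of "t - c"] right[of "t - d"]
    by (auto simp: \<phi>_def not_le)
  have "flat_exp_algebra \<psi>"
    unfolding \<psi>_def
    by (intro flat_exp_algebra.add flat_exp_algebra_scale flat_exp_algebra_translate
        flat_exp_algebra_smooth_cutoff)
  then have smooth: "(deriv ^^ j) \<phi> differentiable (at t)" for j t
  proof (cases j)
    case 0
    then show ?thesis using D\<phi> real_differentiable_def by auto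
  next
    case (Suc i)
    then show ?thesis
      using flat_exp_algebra_smooth[OF \<open>flat_exp_algebra \<psi>\<close>, of i t] deriv
      by (simp add: funpow_swap1)
  qed
  have supp: "closure {t. \<phi> t \<noteq> 0} \<subseteq> {c..d + \<delta>}"
    using zero by (intro closure_minimal) blast+
  have "compact (closure {t. \<phi> t \<noteq> 0})"
    using compact_Int_closed[OF compact_Icc closed_closure] supp by (metis Int_absorb1)
  then have "test_function_on U \<phi>"
    using smooth supp assms(3) by (auto simp: test_function_on_def)
  moreover have "\<bar>\<phi> t\<bar> \<le> \<delta> * indicator {c..d + \<delta>} t" for t
    using zero[of t] lo[of "t - c"] hi[of "t - c"] lo[of "t - d"] hi[of "t - d"] height
    by (auto simp: \<phi>_def indicator_def)
  ultimately show ?thesis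
    using that[of \<phi>] deriv by (simp add: \<psi>_def)
qed


section \<open>Bounded distributional derivatives\<close>

text \<open>Testing against \<open>\<phi>\<close> with \<open>\<phi>'\<close> close to the difference of the indicators of \<open>(c, c + \<delta>)\<close> and
\<open>(d, d + \<delta>)\<close> yields the difference of the two integrals of \<open>u\<close> on one side.  On the other side
stands the integral of \<open>D \<phi>\<close>, where \<open>\<bar>\<phi>\<bar> \<le> \<delta>\<close> is supported in \<open>[c, d + \<delta>]\<close>.  The bound is of the right
order: after division by \<open>\<delta>\<close> it tends to \<open>C (d - c)\<close>.\<close>

lemma distributional_derivative_bounded_increments:
  assumes u: "has_distributional_derivative_on u D U"
    and C: "\<And>t. t \<in> U \<Longrightarrow> \<bar>D t\<bar> \<le> C"
    and cd: "c < d" "0 < \<delta>" "{c..d + \<delta>} \<subseteq> U"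
  shows "\<bar>(LINT t:{c<..<c + \<delta>}|lborel. u t) - (LINT t:{d<..<d + \<delta>}|lborel. u t)\<bar>
    \<le> C * \<delta> * (d + \<delta> - c)"
proof -
  define K where "K = {c..d + \<delta>}"
  define v where "v t = indicator K t * u t" for t
  define \<psi> where "\<psi> k t = smooth_cutoff k \<delta> (t - c) - smooth_cutoff k \<delta> (t - d)" for k t
  define \<psi>' where "\<psi>' t = (indicator {c<..<c + \<delta>} t - indicator {d<..<d + \<delta>} t :: real)" for t
  have K: "K \<subseteq> U" "compact K"
    using cd by (auto simp: K_def)
  have "set_integrable lborel K u"
    using u K by (auto simp: has_distributional_derivative_on_def locally_integrable_on_def)
  then have v: "integrable lborel v"
    by (simp add: set_integrable_def v_def [abs_def])
  have "c \<in> U"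
    using cd by auto
  then have C0: "0 \<le> C"
    using C[of c] by linarith
  have bound: "\<bar>LINT t|lborel. v t * \<psi> k t\<bar> \<le> C * \<delta> * (d + \<delta> - c)" for k
  proof -
    obtain \<phi> where \<phi>: "test_function_on U \<phi>" "deriv \<phi> = \<psi> k"
      "\<And>t. \<bar>\<phi> t\<bar> \<le> \<delta> * indicator K t"
      using test_function_translated_cutoffs[OF cd, of k] by (auto simp: \<psi>_def[abs_def] K_def)
    have "(LINT t|lborel. v t * \<psi> k t) = (LINT t:U|lborel. u t * deriv \<phi> t)"
      unfolding set_lebesgue_integral_def
    proof (rule Bochner_Integration.integral_cong)
      fix t :: real
      show "v t * \<psi> k t = indicat_real U t *\<^sub>R (u t * deriv \<phi> t)"
      proof (cases "t \<in> K")
        case True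
        then show ?thesis using K by (auto simp: v_def \<phi>(2))
      next
        case False
        then have "\<psi> k t = 0"
          using cd by (auto simp: K_def \<psi>_def smooth_cutoff_eq_0)
        then show ?thesis by (simp add: \<phi>(2))
      qed
    qed simp
    also have "\<dots> = - (LINT t:U|lborel. D t * \<phi> t)"
      using u \<phi>(1) by (auto simp: has_distributional_derivative_on_def)
    also have "\<bar>\<dots>\<bar> \<le> (LINT t|lborel. \<bar>indicat_real U t *\<^sub>R (D t * \<phi> t)\<bar>)"
      using integral_norm_bound[of lborel "\<lambda>t. indicat_real U t *\<^sub>R (D t * \<phi> t)"]
      by (simp add: set_lebesgue_integral_def)
    also have "\<dots> \<le> (LINT t|lborel. C * \<delta> * indicat_real K t)"
    proof (rule integral_mono')
      fix t :: real
      show "\<bar>indicat_real U t *\<^sub>R (D t * \<phi> t)\<bar> \<le> C * \<delta> * indicat_real K t"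
        using mult_mono[OF C[of t] \<phi>(3)[of t] C0] C0 cd(2)
        by (auto simp: abs_mult indicator_def)
    qed (use C0 cd in \<open>auto simp: K_def\<close>)
    also have "\<dots> = C * \<delta> * (d + \<delta> - c)"
      using cd by (simp add: K_def)
    finally show ?thesis .
  qed
  have vm[measurable]: "v \<in> borel_measurable borel"
    using v by (auto dest: borel_measurable_integrable)
  have "(\<lambda>k. LINT t|lborel. v t * \<psi> k t) \<longlonglongrightarrow> (LINT t|lborel. v t * \<psi>' t)"
  proof (rule integral_dominated_convergence)
    show "(\<lambda>t. v t * \<psi>' t) \<in> borel_measurable lborel"
      unfolding \<psi>'_def by measurable
    show "(\<lambda>t. v t * \<psi> k t) \<in> borel_measurable lborel" for k
      unfolding \<psi>_def by measurable
    show "integrable lborel (\<lambda>t. \<bar>v t\<bar>)"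
      using v by simp
    show "AE t in lborel. (\<lambda>k. v t * \<psi> k t) \<longlonglongrightarrow> v t * \<psi>' t"
    proof (rule AE_I2)
      fix t :: real
      have "(\<lambda>k. \<psi> k t) \<longlonglongrightarrow> indicator {0<..<\<delta>} (t - c) - indicator {0<..<\<delta>} (t - d)"
        unfolding \<psi>_def by (intro tendsto_diff smooth_cutoff_tendsto)
      also have "indicator {0<..<\<delta>} (t - c) - indicator {0<..<\<delta>} (t - d) = \<psi>' t"
        by (auto simp: \<psi>'_def indicator_def)
      finally show "(\<lambda>k. v t * \<psi> k t) \<longlonglongrightarrow> v t * \<psi>' t"
        by (intro tendsto_mult tendsto_const)
    qed
    show "AE t in lborel. norm (v t * \<psi> k t) \<le> \<bar>v t\<bar>" for k
    proof (rule AE_I2)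
      fix t :: real
      have "\<bar>\<psi> k t\<bar> \<le> 1"
        using smooth_cutoff_bounds[of k \<delta> "t - c"] smooth_cutoff_bounds[of k \<delta> "t - d"]
        by (auto simp: \<psi>_def)
      then show "norm (v t * \<psi> k t) \<le> \<bar>v t\<bar>"
        by (simp add: abs_mult mult_left_le)
    qed
  qed
  then have "(\<lambda>k. \<bar>LINT t|lborel. v t * \<psi> k t\<bar>) \<longlonglongrightarrow> \<bar>LINT t|lborel. v t * \<psi>' t\<bar>"
    by (rule tendsto_rabs)
  then have "\<bar>LINT t|lborel. v t * \<psi>' t\<bar> \<le> C * \<delta> * (d + \<delta> - c)"
    by (rule LIMSEQ_le_const2) (use bound in auto)
  also have "(LINT t|lborel. v t * \<psi>' t)
    = (LINT t:{c<..<c + \<delta>}|lborel. v t) - (LINT t:{d<..<d + \<delta>}|lborel. v t)"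
  proof -
    have "set_integrable lborel A v" if "A \<in> sets borel" for A
      using integrable_mult_indicator[of A lborel v] that v by (simp add: set_integrable_def)
    then show ?thesis
      by (simp add: set_lebesgue_integral_def set_integrable_def \<psi>'_def
          algebra_simps)
  qed
  also have "(LINT t:{c<..<c + \<delta>}|lborel. v t) = (LINT t:{c<..<c + \<delta>}|lborel. u t)"
    using cd by (intro set_lebesgue_integral_cong) (auto simp: v_def K_def)
  also have "(LINT t:{d<..<d + \<delta>}|lborel. v t) = (LINT t:{d<..<d + \<delta>}|lborel. u t)"
    using cd by (intro set_lebesgue_integral_cong) (auto simp: v_def K_def)
  finally show ?thesis .
qed

text \<open>Lebesgue's differentiation theorem with one-sided intervals, transferred from the gauge integral.\<close>

lemma AE_lborel_average_tendsto:
  fixes f :: "real \<Rightarrow> real"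
  assumes "integrable lborel f"
  shows "AE t in lborel. ((\<lambda>\<delta>. (LINT s:{t<..<t + \<delta>}|lborel. f s) / \<delta>) \<longlongrightarrow> f t) (at_right 0)"
proof -
  have si: "set_integrable lborel A f" if "A \<in> sets borel" for A
    using integrable_mult_indicator[of A lborel f] that assms by (simp add: set_integrable_def)
  have int: "f integrable_on cbox a b" for a b
    using integrable_on_lborel[OF assms] integrable_on_subcbox by blast
  obtain N where N: "negligible N" "\<And>x e. \<lbrakk>x \<notin> N; 0 < e\<rbrakk> \<Longrightarrow>
      \<exists>d>0. \<forall>h. 0 < h \<and> h < d \<longrightarrow>
        norm (integral (cbox x (x + h *\<^sub>R One)) f /\<^sub>R h ^ DIM(real) - f x) < e"
    using integrable_ccontinuous_explicit[OF int] by blast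
  have lim: "((\<lambda>\<delta>. (LINT s:{t<..<t + \<delta>}|lborel. f s) / \<delta>) \<longlongrightarrow> f t) (at_right 0)" if tN: "t \<notin> N" for t
  proof (rule tendstoI)
    fix e :: real assume "e > 0"
    obtain d where d: "d > 0" "\<And>h. 0 < h \<Longrightarrow> h < d \<Longrightarrow>
        \<bar>integral {t..t + h} f / h - f t\<bar> < e"
      using N(2)[OF tN \<open>e > 0\<close>] by (auto simp: divide_inverse mult.commute)
    have "dist ((LINT s:{t<..<t + h}|lborel. f s) / h) (f t) < e" if "0 < h" "h < d" for h
      using d(2)[OF that] si[of "{t<..<t + h}"]
      by (simp add: dist_real_def set_borel_integral_eq_integral(2) integral_open_interval_real)
    then show "\<forall>\<^sub>F h in at_right 0. dist ((LINT s:{t<..<t + h}|lborel. f s) / h) (f t) < e"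
      using d(1) by (auto simp: eventually_at dist_real_def intro!: exI[of _ d])
  qed
  from N(1) obtain N' where "N' \<in> null_sets lborel" "N \<subseteq> N'"
    by (auto simp: negligible_iff_null_sets null_sets_completion_iff2)
  then show ?thesis
    using lim by (intro AE_I'[of N']) auto
qed

text \<open>At the fixed base point an almost-everywhere statement says nothing, so convergence of the averages
there has to come from continuity.\<close>

lemma average_tendsto_of_isCont:
  fixes f :: "real \<Rightarrow> real"
  assumes "set_integrable lborel {c..e} f" "c < e" "isCont f c"
  shows "((\<lambda>\<delta>. (LINT s:{c<..<c + \<delta>}|lborel. f s) / \<delta>) \<longlongrightarrow> f c) (at_right 0)"
proof -
  have "((\<lambda>x. integral {c..x} f) has_real_derivative f c) (at c within {c..e})"
    using assms integral_has_vector_derivative_continuous_at[of f c e c "{}"]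
    by (simp add: set_borel_integral_eq_integral(1) continuous_at_imp_continuous_within
        has_real_derivative_iff_has_vector_derivative)
  then have "((\<lambda>x. integral {c..x} f / (x - c)) \<longlongrightarrow> f c) (at_right c)"
    using assms(2) by (simp add: has_field_derivative_iff at_within_Icc_at_right)
  then have "((\<lambda>\<delta>. integral {c..c + \<delta>} f / \<delta>) \<longlongrightarrow> f c) (at_right 0)"
    by (subst (asm) filterlim_at_right_to_0) (simp add: add.commute)
  moreover have "\<forall>\<^sub>F \<delta> in at_right 0.
      integral {c..c + \<delta>} f / \<delta> = (LINT s:{c<..<c + \<delta>}|lborel. f s) / \<delta>"
  proof -
    have "(LINT s:{c<..<c + \<delta>}|lborel. f s) = integral {c..c + \<delta>} f" if "\<delta> < e - c" for \<delta>
      using set_integrable_subset[OF assms(1), of "{c<..<c + \<delta>}"] that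
      by (simp add: set_borel_integral_eq_integral(2) integral_open_interval_real subset_eq)
    then show ?thesis
      using assms(2) by (auto simp: eventually_at dist_real_def intro!: exI[of _ "e - c"])
  qed
  ultimately show ?thesis
    by (rule Lim_transform_eventually)
qed

text \<open>A function with bounded distributional derivative agrees almost everywhere with a Lipschitz
function.  At a given point it may have any value, unless it is continuous there; at such a point
\<open>c\<close> the Lipschitz estimate relating \<open>c\<close> to almost every other point survives.  Both averages in the
bound on increments converge as \<open>\<delta>\<close> tends to \<open>0\<close>.\<close>

lemma distributional_derivative_bounded_AE_Lipschitz:
  assumes u: "has_distributional_derivative_on u D U"
    and C: "\<And>t. t \<in> U \<Longrightarrow> \<bar>D t\<bar> \<le> C"
    and U: "{c..e} \<subseteq> U" and cont: "isCont u c"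
  shows "AE t in lborel. t \<in> {c<..<e} \<longrightarrow> \<bar>u t - u c\<bar> \<le> C * (t - c)"
proof (cases "c < e")
  case True
  have si: "set_integrable lborel {c..e} u"
    using u U by (auto simp: has_distributional_derivative_on_def locally_integrable_on_def)
  define f where "f t = indicator {c..e} t * u t" for t
  have "integrable lborel f"
    using si by (simp add: set_integrable_def f_def[abs_def])
  from AE_lborel_average_tendsto[OF this] show ?thesis
  proof eventually_elim
    case (elim t)
    show ?case
    proof
      assume t: "t \<in> {c<..<e}"
      have small: "\<forall>\<^sub>F \<delta> in at_right 0. 0 < \<delta> \<and> \<delta> < e - t"
        using t by (auto simp: eventually_at dist_real_def intro!: exI[of _ "e - t"])
      have "\<forall>\<^sub>F \<delta> in at_right 0. (LINT s:{t<..<t + \<delta>}|lborel. f s) / \<delta>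
          = (LINT s:{t<..<t + \<delta>}|lborel. u s) / \<delta>"
        using small
      proof eventually_elim
        case (elim \<delta>)
        then have "(LINT s:{t<..<t + \<delta>}|lborel. f s) = (LINT s:{t<..<t + \<delta>}|lborel. u s)"
          using t by (intro set_lebesgue_integral_cong) (auto simp: f_def)
        then show ?case by simp
      qed
      with elim have "((\<lambda>\<delta>. (LINT s:{t<..<t + \<delta>}|lborel. u s) / \<delta>) \<longlongrightarrow> f t) (at_right 0)"
        by (rule Lim_transform_eventually)
      moreover have "f t = u t"
        using t by (simp add: f_def)
      ultimately have lim: "((\<lambda>\<delta>. \<bar>(LINT s:{c<..<c + \<delta>}|lborel. u s) / \<delta>
          - (LINT s:{t<..<t + \<delta>}|lborel. u s) / \<delta>\<bar>) \<longlongrightarrow> \<bar>u c - u t\<bar>) (at_right 0)"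
        using average_tendsto_of_isCont[OF si True cont]
        by (intro tendsto_rabs tendsto_diff) simp_all
      have "((\<lambda>\<delta>. C * (t + \<delta> - c)) \<longlongrightarrow> C * (t + 0 - c)) (at_right 0)"
        by (intro tendsto_intros)
      moreover have "\<forall>\<^sub>F \<delta> in at_right 0. \<bar>(LINT s:{c<..<c + \<delta>}|lborel. u s) / \<delta>
          - (LINT s:{t<..<t + \<delta>}|lborel. u s) / \<delta>\<bar> \<le> C * (t + \<delta> - c)"
        using small
      proof eventually_elim
        case (elim \<delta>)
        then have "{c..t + \<delta>} \<subseteq> U"
          using U t by auto
        with elim t show ?case
          using distributional_derivative_bounded_increments[OF u C, of c t \<delta>]
          by (simp add: diff_divide_distrib[symmetric] pos_divide_le_eq mult_ac)
      qed
      ultimately have "\<bar>u c - u t\<bar> \<le> C * (t + 0 - c)"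
        by (rule tendsto_le[OF trivial_limit_at_right_real _ lim])
      then show "\<bar>u t - u c\<bar> \<le> C * (t - c)"
        by (simp add: abs_minus_commute)
    qed
  qed
qed simp


text \<open>Integration by parts over a bounded interval that contains the support of the test function.  The
\<open>C\<^sup>1\<close> function \<open>v\<close> is separated from \<open>u\<close> because a product \<open>f(x; \<theta>) g(x; \<theta>)\<close> is given by a regular
formula only for parameters in \<open>\<Theta>\<close>.\<close>

lemma C1_has_distributional_derivative_on:
  assumes v: "\<And>t. (v has_real_derivative v' t) (at t)" "\<And>t. isCont v' t"
    and eq: "\<And>t. t \<in> U \<Longrightarrow> u t = v t"
  shows "has_distributional_derivative_on u v' U"
  unfolding has_distributional_derivative_on_def
proof (intro conjI allI impI)
  have int: "set_integrable lborel K w" if "compact K" "\<And>t. isCont w t" for K and w :: "real \<Rightarrow> real"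
    unfolding set_integrable_def using that
    by (intro borel_integrable_compact continuous_at_imp_continuous_on) auto
  show "locally_integrable_on U v'"
    using v(2) by (auto simp: locally_integrable_on_def intro: int)
  show "locally_integrable_on U u"
    unfolding locally_integrable_on_def
  proof safe
    fix K assume "compact K" "K \<subseteq> U"
    then show "set_integrable lborel K u"
      using int[of K v] DERIV_isCont[OF v(1)] eq
      by (subst set_integrable_cong[of lborel lborel K K u v]) auto
  qed
  fix \<phi> assume \<phi>: "test_function_on U \<phi>"
  define K where "K = closure {t. \<phi> t \<noteq> 0}"
  have K: "compact K" "K \<subseteq> U" "closed K"
    using \<phi> by (auto simp: test_function_on_def K_def)
  have \<phi>0: "\<phi> t = 0" if "t \<notin> K" for t
    using that closure_subset[of "{t. \<phi> t \<noteq> 0}"] by (auto simp: K_def)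
  have D\<phi>: "(\<phi> has_real_derivative deriv \<phi> t) (at t)" for t
    using \<phi> unfolding test_function_on_def
    by (metis DERIV_deriv_iff_real_differentiable funpow_0)
  have \<phi>'cont: "isCont (deriv \<phi>) t" for t
  proof -
    have "(deriv ^^ 1) \<phi> differentiable (at t)"
      using \<phi> unfolding test_function_on_def by blast
    then show ?thesis
      by (simp add: differentiable_imp_continuous_within)
  qed
  have \<phi>'0: "deriv \<phi> t = 0" if "t \<notin> K" for t
  proof -
    have "(\<phi> has_real_derivative 0) (at t)"
      by (rule has_field_derivative_transform_within_open[OF DERIV_const, of "- K"])
        (use that \<phi>0 K in \<open>auto simp: open_Compl\<close>)
    then show ?thesis by (rule DERIV_imp_deriv)
  qed
  obtain b where b: "\<And>t. t \<in> K \<Longrightarrow> \<bar>t\<bar> \<le> b"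
    using compact_imp_bounded[OF K(1)] by (auto simp: bounded_iff)
  define p where "p = \<bar>b\<bar> + 1"
  have Kp: "K \<subseteq> {-p..p}" and ends: "-p \<notin> K" "p \<notin> K" "-p \<le> p"
    using b by (fastforce simp: p_def)+
  have restrict: "(LINT t:U|lborel. w t) = (LINT t|lborel. w' t * indicator {-p..p} t)"
    if "\<And>t. t \<in> K \<Longrightarrow> w t = w' t" "\<And>t. t \<notin> K \<Longrightarrow> w t = 0" "\<And>t. t \<notin> K \<Longrightarrow> w' t = 0"
    for w w' :: "real \<Rightarrow> real"
    unfolding set_lebesgue_integral_def
  proof (rule Bochner_Integration.integral_cong)
    fix t :: real
    show "indicat_real U t *\<^sub>R w t = w' t * indicator {-p..p} t"
      using that[of t] K(2) Kp by (cases "t \<in> K") (auto simp: indicator_def)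
  qed simp
  have "(LINT t:U|lborel. u t * deriv \<phi> t) = (LINT t|lborel. (v t * deriv \<phi> t) * indicator {-p..p} t)"
    by (rule restrict) (use K eq \<phi>'0 in auto)
  also have "\<dots> = v p * \<phi> p - v (-p) * \<phi> (-p)
      - (LINT t|lborel. (v' t * \<phi> t) * indicator {-p..p} t)"
    by (rule integral_by_parts) (use ends v \<phi>'cont D\<phi> in auto)
  also have "\<dots> = - (LINT t|lborel. (v' t * \<phi> t) * indicator {-p..p} t)"
    using \<phi>0[OF ends(1)] \<phi>0[OF ends(2)] by simp
  also have "(LINT t|lborel. (v' t * \<phi> t) * indicator {-p..p} t) = (LINT t:U|lborel. v' t * \<phi> t)"
    by (rule restrict[symmetric]) (use \<phi>0 in auto)
  finally show "(LINT t:U|lborel. u t * deriv \<phi> t) = - (LINT t:U|lborel. v' t * \<phi> t)" .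
qed


section \<open>Differentiating under the integral sign\<close>

lemma AE_lborel_ex_between:
  fixes a b :: real
  assumes "AE t in lborel. P t" "a < b"
  shows "\<exists>t\<in>{a<..<b}. P t"
proof (rule ccontr)
  assume "\<not> ?thesis"
  then have "AE t in lborel. t \<notin> {a<..<b}"
    using assms(1) by (auto elim: eventually_mono)
  then have "{a<..<b} \<in> null_sets lborel"
    by (subst (asm) AE_iff_null_sets[symmetric]) auto
  then show False
    using assms(2) by (auto simp: null_sets_def)
qed

text \<open>If \<open>\<integral> u(x, \<theta>) d\<mu>(x)\<close> does not depend on \<open>\<theta>\<close>, the difference quotients of \<open>u\<close> at \<open>\<theta>\<^sub>0\<close> integrate to
\<open>0\<close>, and the claim is dominated convergence.  The domination, however, is only known for the
distributional derivative, hence for each \<open>x\<close> at almost every \<open>\<theta>\<close> with an exceptional set depending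
on \<open>x\<close>.  By Fubini, almost every \<open>\<theta>\<close> is good for almost every \<open>x\<close>, so some sequence of good parameters
converges to \<open>\<theta>\<^sub>0\<close>; the existence of the classical derivative at \<open>\<theta>\<^sub>0\<close> makes the limit along one
sequence suffice.  The alternative that \<open>u x\<close> vanishes
covers the \<open>x\<close> at which the densities vanish for all parameters in \<open>\<Theta>\<^sub>0\<close>, for
which the Stein class says nothing about the distributional derivative.\<close>

lemma has_bochner_integral_parameter_derivative_0:
  fixes u D :: "real \<Rightarrow> real \<Rightarrow> real"
  assumes "sigma_finite_measure \<mu>" and sets: "sets \<mu> = sets borel"
    and um: "(\<lambda>(x, \<theta>). u x \<theta>) \<in> borel_measurable (borel \<Otimes>\<^sub>M restrict_space borel \<Theta>)"
    and T: "open \<Theta>\<^sub>0" "\<theta>\<^sub>0 \<in> \<Theta>\<^sub>0" "\<Theta>\<^sub>0 \<subseteq> \<Theta>"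
    and const: "\<And>\<theta>. \<theta> \<in> \<Theta>\<^sub>0 \<Longrightarrow> has_bochner_integral \<mu> (\<lambda>x. u x \<theta>) c"
    and weak: "\<And>x. (\<forall>\<theta>\<in>\<Theta>\<^sub>0. u x \<theta> = 0) \<or> has_distributional_derivative_on (u x) (D x) \<Theta>\<^sub>0"
    and h: "integrable \<mu> h" "\<And>x \<theta>. \<theta> \<in> \<Theta>\<^sub>0 \<Longrightarrow> \<bar>D x \<theta>\<bar> \<le> h x"
    and deriv: "AE x in \<mu>. (u x has_real_derivative u' x) (at \<theta>\<^sub>0)"
    and u'm: "u' \<in> borel_measurable \<mu>"
  shows "has_bochner_integral \<mu> u' 0"
proof -
  interpret \<mu>: sigma_finite_measure \<mu> by fact
  interpret pair_sigma_finite \<mu> lborel ..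
  obtain r where r: "r > 0" "{\<theta>\<^sub>0..\<theta>\<^sub>0 + r} \<subseteq> \<Theta>\<^sub>0"
  proof -
    obtain e where "e > 0" "cball \<theta>\<^sub>0 e \<subseteq> \<Theta>\<^sub>0"
      using T open_contains_cball by blast
    moreover have "{\<theta>\<^sub>0..\<theta>\<^sub>0 + e} \<subseteq> cball \<theta>\<^sub>0 e"
      by (auto simp: dist_real_def)
    ultimately show ?thesis using that by blast
  qed
  define I where "I = {\<theta>\<^sub>0<..<\<theta>\<^sub>0 + r}"
  \<comment> \<open>Joint measurability is only known for parameters in \<open>\<Theta>\<close>; retracting the line to \<open>I \<union> {\<theta>\<^sub>0}\<close>
    gives a function that is jointly measurable on the plane.\<close>
  define \<kappa> where "\<kappa> \<theta> = (if \<theta> \<in> I then \<theta> else \<theta>\<^sub>0)" for \<theta>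
  have I: "I \<subseteq> \<Theta>\<^sub>0" "I \<subseteq> \<Theta>" "\<theta>\<^sub>0 \<in> \<Theta>"
    using r T by (fastforce simp: I_def)+
  have "\<kappa> \<in> borel \<rightarrow>\<^sub>M borel"
    unfolding \<kappa>_def I_def by measurable
  then have "\<kappa> \<in> borel \<rightarrow>\<^sub>M restrict_space borel \<Theta>"
    by (rule measurable_restrict_space2[rotated]) (use I in \<open>auto simp: \<kappa>_def\<close>)
  then have "(\<lambda>p. (fst p, \<kappa> (snd p))) \<in> borel \<Otimes>\<^sub>M borel \<rightarrow>\<^sub>M borel \<Otimes>\<^sub>M restrict_space borel \<Theta>"
    by measurable
  from measurable_compose[OF this um]
  have "(\<lambda>p. u (fst p) (\<kappa> (snd p))) \<in> borel_measurable (borel \<Otimes>\<^sub>M borel)"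
    by simp
  moreover have [measurable_cong]: "sets (\<mu> \<Otimes>\<^sub>M lborel) = sets (borel \<Otimes>\<^sub>M borel)"
    using sets by (intro sets_pair_measure_cong) auto
  ultimately have [measurable]: "(\<lambda>p. u (fst p) (\<kappa> (snd p))) \<in> borel_measurable (\<mu> \<Otimes>\<^sub>M lborel)"
    using measurable_cong_sets by blast
  have [measurable]: "h \<in> borel_measurable \<mu>" "(\<lambda>x. u x \<theta>\<^sub>0) \<in> borel_measurable \<mu>"
    using h(1) const[OF T(2)] by (auto simp: has_bochner_integral_iff)
  let ?P = "\<lambda>x \<theta>. \<theta> \<in> I \<longrightarrow> \<bar>u x (\<kappa> \<theta>) - u x \<theta>\<^sub>0\<bar> \<le> h x * (\<theta> - \<theta>\<^sub>0)"
  have "{p \<in> space (\<mu> \<Otimes>\<^sub>M lborel). ?P (fst p) (snd p)} \<in> sets (\<mu> \<Otimes>\<^sub>M lborel)"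
    unfolding I_def by measurable
  then have swap: "(AE x in \<mu>. AE \<theta> in lborel. ?P x \<theta>) \<longleftrightarrow> (AE \<theta> in lborel. AE x in \<mu>. ?P x \<theta>)"
    by (rule AE_commute)
  have "AE x in \<mu>. AE \<theta> in lborel. ?P x \<theta>"
    using deriv
  proof eventually_elim
    case (elim x)
    have "AE \<theta> in lborel. \<theta> \<in> I \<longrightarrow> \<bar>u x \<theta> - u x \<theta>\<^sub>0\<bar> \<le> h x * (\<theta> - \<theta>\<^sub>0)"
      using weak[of x]
    proof
      assume "\<forall>\<theta>\<in>\<Theta>\<^sub>0. u x \<theta> = 0"
      moreover have "0 \<le> h x"
        using h(2)[OF T(2), of x] by linarith
      ultimately show ?thesis
        using I T by (intro AE_I2) (auto simp: I_def subset_eq)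
    next
      assume "has_distributional_derivative_on (u x) (D x) \<Theta>\<^sub>0"
      then show ?thesis
        unfolding I_def using h(2) r(2) DERIV_isCont[OF elim]
        by (rule distributional_derivative_bounded_AE_Lipschitz)
    qed
    then show ?case
      by eventually_elim (auto simp: \<kappa>_def)
  qed
  then have good: "AE \<theta> in lborel. AE x in \<mu>. ?P x \<theta>"
    using swap by simp
  have "\<exists>\<theta>\<in>{\<theta>\<^sub>0<..<\<theta>\<^sub>0 + r / (real n + 1)}. AE x in \<mu>. ?P x \<theta>" for n
    using r(1) by (intro AE_lborel_ex_between good) (auto intro!: divide_pos_pos)
  then have "\<forall>n. \<exists>\<theta>. \<theta> \<in> {\<theta>\<^sub>0<..<\<theta>\<^sub>0 + r / (real n + 1)} \<and> (AE x in \<mu>. ?P x \<theta>)"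
    by blast
  from choice[OF this] obtain \<theta> where
    "\<forall>n. \<theta> n \<in> {\<theta>\<^sub>0<..<\<theta>\<^sub>0 + r / (real n + 1)} \<and> (AE x in \<mu>. ?P x (\<theta> n))" ..
  then have \<theta>: "\<And>n. \<theta> n \<in> {\<theta>\<^sub>0<..<\<theta>\<^sub>0 + r / (real n + 1)}"
    "\<And>n. AE x in \<mu>. ?P x (\<theta> n)"
    by blast+
  have \<theta>I: "\<theta> n \<in> I" for n
  proof -
    have "r / (real n + 1) \<le> r"
      using r(1) by (simp add: divide_le_eq)
    then show ?thesis
      using \<theta>(1)[of n] by (auto simp: I_def)
  qed
  have \<theta>lim: "filterlim \<theta> (at \<theta>\<^sub>0) sequentially"
  proof -
    have "(\<lambda>n. \<theta>\<^sub>0 + r * inverse (real (Suc n))) \<longlonglongrightarrow> \<theta>\<^sub>0 + r * 0"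
      by (intro tendsto_intros LIMSEQ_inverse_real_of_nat)
    then have "\<theta> \<longlonglongrightarrow> \<theta>\<^sub>0"
      using \<theta>(1) less_imp_le
      by (intro tendsto_sandwich[of "\<lambda>_. \<theta>\<^sub>0" \<theta> sequentially "\<lambda>n. \<theta>\<^sub>0 + r * inverse (real (Suc n))"])
        (auto simp: divide_inverse add.commute intro!: always_eventually less_imp_le)
    moreover have "\<theta> n \<noteq> \<theta>\<^sub>0" for n
      using \<theta>I[of n] by (auto simp: I_def)
    ultimately show ?thesis
      by (auto simp: filterlim_at)
  qed
  define s where "s n x = (u x (\<theta> n) - u x \<theta>\<^sub>0) / (\<theta> n - \<theta>\<^sub>0)" for n x
  have s: "has_bochner_integral \<mu> (s n) 0" for n
  proof -
    have "has_bochner_integral \<mu> (\<lambda>x. u x (\<theta> n) - u x \<theta>\<^sub>0) (c - c)"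
      using \<theta>I I T by (intro has_bochner_integral_diff const) auto
    then show ?thesis
      unfolding s_def[abs_def] using has_bochner_integral_divide_zero by fastforce
  qed
  have sm: "s n \<in> borel_measurable \<mu>" for n
    using s by (auto simp: has_bochner_integral_iff)
  have lim: "AE x in \<mu>. (\<lambda>n. s n x) \<longlonglongrightarrow> u' x"
    using deriv
  proof eventually_elim
    case (elim x)
    then show ?case
      unfolding s_def has_field_derivative_iff by (rule filterlim_compose[OF _ \<theta>lim])
  qed
  have bound: "AE x in \<mu>. norm (s n x) \<le> h x" for n
    using \<theta>(2)[of n]
  proof eventually_elim
    case (elim x)
    then show ?case
      using \<theta>I[of n] by (auto simp: s_def \<kappa>_def I_def abs_mult pos_divide_le_eq)
  qed
  have "integrable \<mu> u'"
    by (rule integrable_dominated_convergence[OF u'm sm h(1) lim bound])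
  moreover have "(\<lambda>n. integral\<^sup>L \<mu> (s n)) \<longlonglongrightarrow> integral\<^sup>L \<mu> u'"
    by (rule integral_dominated_convergence[OF u'm sm h(1) lim bound])
  then have "integral\<^sup>L \<mu> u' = 0"
    using s by (simp add: has_bochner_integral_iff LIMSEQ_const_iff)
  ultimately show ?thesis
    by (simp add: has_bochner_integral_iff)
qed


section \<open>Stein operators of parametric densities\<close>

lemma measurable_at_parameter:
  assumes "(\<lambda>(x, \<theta>). F x \<theta>) \<in> borel_measurable (borel \<Otimes>\<^sub>M restrict_space borel \<Theta>)" "\<theta> \<in> \<Theta>"
  shows "(\<lambda>x. F x \<theta>) \<in> borel_measurable (borel :: real measure)"
  using measurable_Pair1[OF assms(1), of \<theta>] assms(2) by (simp add: space_restrict_space)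

lemma density_support_measurable:
  assumes "g \<in> parametric_densities \<mu> \<Theta>" "\<theta> \<in> \<Theta>"
  shows "density_support g \<theta> \<in> sets borel"
proof -
  have [measurable]: "(\<lambda>x. g x \<theta>) \<in> borel_measurable borel"
    using assms by (auto simp: parametric_densities_def intro: measurable_at_parameter)
  show ?thesis
    unfolding density_support_def by measurable
qed

text \<open>On the support of \<open>g(\<cdot>; \<theta>\<^sub>0)\<close> the operator is a limit of difference quotients along a fixed sequence
of parameters in \<open>\<Theta>\<close>; elsewhere it vanishes by the convention on \<open>1/g\<close>.\<close>

lemma stein_operator_measurable:
  assumes g: "g \<in> parametric_densities \<mu> \<Theta>" and f: "f \<in> stein_class \<mu> \<Theta> g \<theta>\<^sub>0"
    and \<theta>\<^sub>0: "\<theta>\<^sub>0 \<in> interior \<Theta>"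
  shows "stein_operator \<theta>\<^sub>0 f g \<in> borel_measurable borel"
proof -
  obtain r where r: "r > 0" "cball \<theta>\<^sub>0 r \<subseteq> \<Theta>"
    using \<theta>\<^sub>0 mem_interior_cball by blast
  define \<theta> where "\<theta> n = \<theta>\<^sub>0 + r * inverse (real (Suc n))" for n
  have \<theta>: "\<theta> n \<in> \<Theta>" "\<theta> n \<noteq> \<theta>\<^sub>0" for n
  proof -
    have "inverse (real (Suc n)) \<le> 1"
      by (simp add: inverse_le_1_iff)
    then have "\<theta> n \<in> cball \<theta>\<^sub>0 r"
      using r(1) mult_left_le[of "inverse (real (Suc n))" r] by (simp add: \<theta>_def dist_real_def)
    then show "\<theta> n \<in> \<Theta>" "\<theta> n \<noteq> \<theta>\<^sub>0"
      using r by (auto simp: \<theta>_def)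
  qed
  have "\<theta> \<longlonglongrightarrow> \<theta>\<^sub>0 + r * 0"
    unfolding \<theta>_def by (intro tendsto_intros LIMSEQ_inverse_real_of_nat)
  then have \<theta>lim: "filterlim \<theta> (at \<theta>\<^sub>0) sequentially"
    using \<theta>(2) by (simp add: filterlim_at)
  have "\<theta>\<^sub>0 \<in> \<Theta>"
    using \<theta>\<^sub>0 interior_subset by blast
  have S[measurable]: "density_support g \<theta>\<^sub>0 \<in> sets borel"
    using g \<open>\<theta>\<^sub>0 \<in> \<Theta>\<close> by (rule density_support_measurable)
  have [measurable]: "(\<lambda>x. f x t) \<in> borel_measurable borel" "(\<lambda>x. g x t) \<in> borel_measurable borel"
    if "t \<in> \<Theta>" for t
    using f g that by (auto simp: parametric_densities_def stein_class_def intro: measurable_at_parameter)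
  have [measurable]: "(\<lambda>x. f x (\<theta> n)) \<in> borel_measurable borel" "(\<lambda>x. f x \<theta>\<^sub>0) \<in> borel_measurable borel"
    "(\<lambda>x. g x (\<theta> n)) \<in> borel_measurable borel" "(\<lambda>x. g x \<theta>\<^sub>0) \<in> borel_measurable borel" for n
    using \<theta>(1) \<open>\<theta>\<^sub>0 \<in> \<Theta>\<close> by auto
  define w where "w n x = (if x \<in> density_support g \<theta>\<^sub>0
    then (f x (\<theta> n) * g x (\<theta> n) - f x \<theta>\<^sub>0 * g x \<theta>\<^sub>0) / (\<theta> n - \<theta>\<^sub>0) / g x \<theta>\<^sub>0 else 0)" for n x
  show ?thesis
  proof (rule borel_measurable_LIMSEQ_real)
    show "w n \<in> borel_measurable borel" for n
      unfolding w_def by measurable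
    fix x :: real
    show "(\<lambda>n. w n x) \<longlonglongrightarrow> stein_operator \<theta>\<^sub>0 f g x"
    proof (cases "x \<in> density_support g \<theta>\<^sub>0")
      case True
      then have "((\<lambda>\<theta>. f x \<theta> * g x \<theta>) has_real_derivative deriv (\<lambda>\<theta>. f x \<theta> * g x \<theta>) \<theta>\<^sub>0) (at \<theta>\<^sub>0)"
        using f DERIV_deriv_iff_real_differentiable by (auto simp: stein_class_def)
      from this[unfolded has_field_derivative_iff]
      have "(\<lambda>n. (f x (\<theta> n) * g x (\<theta> n) - f x \<theta>\<^sub>0 * g x \<theta>\<^sub>0) / (\<theta> n - \<theta>\<^sub>0))
          \<longlonglongrightarrow> deriv (\<lambda>\<theta>. f x \<theta> * g x \<theta>) \<theta>\<^sub>0"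
        by (rule filterlim_compose[OF _ \<theta>lim])
      then show ?thesis
        using True unfolding w_def stein_operator_def density_support_def
        by (simp del: divide_divide_eq_left) (intro tendsto_divide tendsto_const; simp)
    next
      case False
      moreover have "g x \<theta>\<^sub>0 \<ge> 0"
        using g \<open>\<theta>\<^sub>0 \<in> \<Theta>\<close> by (auto simp: parametric_densities_def)
      ultimately show ?thesis
        by (auto simp: w_def stein_operator_def density_support_def)
    qed
  qed
qed

text \<open>Multiplication by \<open>g(x; \<theta>\<^sub>0)\<close> cancels the denominator of the operator, which leaves
\<open>\<partial>\<^sub>\<theta> (f g)\<close> at \<open>\<theta>\<^sub>0\<close>.  Off the support the product is \<open>0\<close> whereas \<open>\<partial>\<^sub>\<theta> (f g)\<close> need not be: \<open>g(x; \<theta>)\<close> may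
become positive for \<open>\<theta>\<close> near \<open>\<theta>\<^sub>0\<close>.  The last hypothesis makes the two agree there.\<close>

lemma stein_identity:
  assumes \<mu>: "sigma_finite_measure \<mu>" "sets \<mu> = sets borel"
    and g: "g \<in> parametric_densities \<mu> \<Theta>" and f: "f \<in> stein_class \<mu> \<Theta> g \<theta>\<^sub>0"
    and \<theta>\<^sub>0: "\<theta>\<^sub>0 \<in> interior \<Theta>"
    and off: "AE x in \<mu>. x \<notin> density_support g \<theta>\<^sub>0 \<longrightarrow>
      ((\<lambda>\<theta>. f x \<theta> * g x \<theta>) has_real_derivative 0) (at \<theta>\<^sub>0)"
  shows "has_bochner_integral \<mu> (\<lambda>x. g x \<theta>\<^sub>0 * stein_operator \<theta>\<^sub>0 f g x) 0"
proof -
  have T: "\<theta>\<^sub>0 \<in> \<Theta>"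
    using \<theta>\<^sub>0 interior_subset by blast
  have gm: "(\<lambda>(x, \<theta>). g x \<theta>) \<in> borel_measurable (borel \<Otimes>\<^sub>M restrict_space borel \<Theta>)"
    and gnn: "\<And>x \<theta>. \<theta> \<in> \<Theta> \<Longrightarrow> 0 \<le> g x \<theta>"
    using g by (auto simp: parametric_densities_def)
  have fm: "(\<lambda>(x, \<theta>). f x \<theta>) \<in> borel_measurable (borel \<Otimes>\<^sub>M restrict_space borel \<Theta>)"
    and diff: "\<And>x. x \<in> density_support g \<theta>\<^sub>0 \<Longrightarrow> (\<lambda>\<theta>. f x \<theta> * g x \<theta>) differentiable (at \<theta>\<^sub>0)"
    using f by (auto simp: stein_class_def)
  from f obtain \<Theta>\<^sub>0 c D h where \<Theta>\<^sub>0: "open \<Theta>\<^sub>0" "\<theta>\<^sub>0 \<in> \<Theta>\<^sub>0" "\<Theta>\<^sub>0 \<subseteq> \<Theta>"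
    and c: "\<forall>\<theta>\<in>\<Theta>\<^sub>0. has_bochner_integral \<mu> (\<lambda>x. f x \<theta> * g x \<theta>) c"
    and D: "\<forall>\<theta>\<in>\<Theta>\<^sub>0. \<forall>x\<in>density_support g \<theta>.
      has_distributional_derivative_on (\<lambda>\<theta>. f x \<theta> * g x \<theta>) (D x) \<Theta>\<^sub>0"
    and h: "integrable \<mu> h" "\<forall>\<theta>\<in>\<Theta>\<^sub>0. \<forall>x. \<bar>D x \<theta>\<bar> \<le> h x"
    unfolding stein_class_def by blast
  have um: "(\<lambda>(x, \<theta>). f x \<theta> * g x \<theta>) \<in> borel_measurable (borel \<Otimes>\<^sub>M restrict_space borel \<Theta>)"
    using borel_measurable_times[OF fm gm] by (simp add: case_prod_beta)
  have weak: "(\<forall>\<theta>\<in>\<Theta>\<^sub>0. f x \<theta> * g x \<theta> = 0) \<or>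
      has_distributional_derivative_on (\<lambda>\<theta>. f x \<theta> * g x \<theta>) (D x) \<Theta>\<^sub>0" for x
  proof (cases "\<exists>\<theta>\<in>\<Theta>\<^sub>0. x \<in> density_support g \<theta>")
    case False
    then have "g x \<theta> = 0" if "\<theta> \<in> \<Theta>\<^sub>0" for \<theta>
      using gnn[of \<theta> x] that \<Theta>\<^sub>0 by (force simp: density_support_def)
    then show ?thesis by simp
  qed (use D in blast)
  have deriv: "AE x in \<mu>. ((\<lambda>\<theta>. f x \<theta> * g x \<theta>) has_real_derivative
      g x \<theta>\<^sub>0 * stein_operator \<theta>\<^sub>0 f g x) (at \<theta>\<^sub>0)"
    using off
  proof eventually_elim
    case (elim x)
    show ?case
    proof (cases "x \<in> density_support g \<theta>\<^sub>0")
      case True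
      then show ?thesis
        using diff[OF True] by (simp add: stein_operator_def density_support_def
            DERIV_deriv_iff_real_differentiable)
    next
      case False
      then have "g x \<theta>\<^sub>0 = 0"
        using gnn[OF T, of x] by (auto simp: density_support_def)
      then show ?thesis
        using elim False by simp
    qed
  qed
  have m: "(\<lambda>x. g x \<theta>\<^sub>0 * stein_operator \<theta>\<^sub>0 f g x) \<in> borel_measurable \<mu>"
    using borel_measurable_times[OF measurable_at_parameter[OF gm T] stein_operator_measurable[OF g f \<theta>\<^sub>0]]
      measurable_cong_sets[OF \<mu>(2) refl] by blast
  show ?thesis
    by (rule has_bochner_integral_parameter_derivative_0[OF \<mu> um \<Theta>\<^sub>0 _ weak h(1) _ deriv m])
      (use c h(2) in auto)
qed

text \<open>The family \<open>f\<close> is chosen such that \<open>f(x; \<theta>) g(x; \<theta>) = (\<theta> - \<theta>\<^sub>0) l(x) g(x; \<theta>\<^sub>0)\<close> is linear in \<open>\<theta>\<close>.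
The more obvious choice \<open>f g = \<integral> l(x) g(x; s) ds\<close> over \<open>[\<theta>\<^sub>0, \<theta>]\<close>, with \<open>l\<close> centred at each \<open>s\<close>,
need not be differentiable at \<open>\<theta>\<^sub>0\<close>, because \<open>g\<close> is merely measurable in its parameter.  As the
support is constant, \<open>g(x; \<theta>)\<close> vanishes only where \<open>g(x; \<theta>\<^sub>0)\<close> does, so no division by zero spoils the
formula.\<close>

lemma linear_perturbation_in_stein_class:
  assumes \<mu>: "sets \<mu> = sets borel" and g: "g \<in> parametric_densities \<mu> \<Theta>"
    and \<theta>\<^sub>0: "\<theta>\<^sub>0 \<in> interior \<Theta>"
    and S: "\<And>\<theta>. \<theta> \<in> \<Theta> \<Longrightarrow> density_support g \<theta> = density_support g \<theta>\<^sub>0"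
    and l: "l \<in> borel_measurable borel" "has_bochner_integral \<mu> (\<lambda>x. l x * g x \<theta>\<^sub>0) 0"
  defines "f \<equiv> \<lambda>x \<theta>. (\<theta> - \<theta>\<^sub>0) * l x * g x \<theta>\<^sub>0 / g x \<theta>"
  shows "f \<in> stein_class \<mu> \<Theta> g \<theta>\<^sub>0"
    and "stein_operator \<theta>\<^sub>0 f g x = (if x \<in> density_support g \<theta>\<^sub>0 then l x else 0)"
proof -
  have T: "\<theta>\<^sub>0 \<in> \<Theta>"
    using \<theta>\<^sub>0 interior_subset by blast
  have gm: "(\<lambda>(x, \<theta>). g x \<theta>) \<in> borel_measurable (borel \<Otimes>\<^sub>M restrict_space borel \<Theta>)"
    and gnn: "\<And>x \<theta>. \<theta> \<in> \<Theta> \<Longrightarrow> 0 \<le> g x \<theta>"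
    using g by (auto simp: parametric_densities_def)
  have fg: "f x \<theta> * g x \<theta> = (\<theta> - \<theta>\<^sub>0) * (l x * g x \<theta>\<^sub>0)" if "\<theta> \<in> \<Theta>" for x \<theta>
  proof (cases "x \<in> density_support g \<theta>\<^sub>0")
    case True
    then have "0 < g x \<theta>"
      using S[OF that] by (auto simp: density_support_def)
    then show ?thesis by (simp add: f_def)
  next
    case False
    then have "g x \<theta>\<^sub>0 = 0"
      using gnn[OF T, of x] by (simp add: density_support_def)
    then show ?thesis by (simp add: f_def)
  qed
  have line: "((\<lambda>\<theta>. (\<theta> - \<theta>\<^sub>0) * a) has_real_derivative a) (at t)" for a t
    by (auto intro!: derivative_eq_intros)
  have deriv: "((\<lambda>\<theta>. f x \<theta> * g x \<theta>) has_real_derivative l x * g x \<theta>\<^sub>0) (at \<theta>\<^sub>0)" for x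
    by (rule has_field_derivative_transform_within_open[OF line open_interior \<theta>\<^sub>0])
      (simp add: fg subsetD[OF interior_subset])
  show "stein_operator \<theta>\<^sub>0 f g x = (if x \<in> density_support g \<theta>\<^sub>0 then l x else 0)"
    using DERIV_imp_deriv[OF deriv[of x]] gnn[OF T, of x]
    by (auto simp: stein_operator_def density_support_def)
  have fm: "(\<lambda>(x, \<theta>). f x \<theta>) \<in> borel_measurable (borel \<Otimes>\<^sub>M restrict_space borel \<Theta>)"
  proof -
    note [measurable] = l(1) measurable_at_parameter[OF gm T]
    have [measurable]: "(\<lambda>p. g (fst p) (snd p)) \<in> borel_measurable (borel \<Otimes>\<^sub>M restrict_space borel \<Theta>)"
      using gm by (simp add: case_prod_beta)
    have [measurable]: "snd \<in> borel_measurable (borel \<Otimes>\<^sub>M restrict_space borel \<Theta>)"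
      by (rule measurable_compose[OF measurable_snd]) (simp add: measurable_restrict_space1)
    show ?thesis
      unfolding f_def case_prod_beta by measurable
  qed
  show "f \<in> stein_class \<mu> \<Theta> g \<theta>\<^sub>0"
    unfolding stein_class_def mem_Collect_eq
  proof (intro conjI exI[of _ "interior \<Theta>"] exI[of _ "0 :: real"]
      exI[of _ "\<lambda>x _. l x * g x \<theta>\<^sub>0"] exI[of _ "\<lambda>x. \<bar>l x * g x \<theta>\<^sub>0\<bar>"] ballI allI)
    show "has_bochner_integral \<mu> (\<lambda>x. f x \<theta> * g x \<theta>) 0" if "\<theta> \<in> interior \<Theta>" for \<theta>
    proof -
      have "\<theta> \<in> \<Theta>"
        using that interior_subset by blast
      then show ?thesis
        using has_bochner_integral_mult_right[of "\<theta> - \<theta>\<^sub>0", OF l(2)] by (simp add: fg)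
    qed
    show "has_distributional_derivative_on (\<lambda>\<theta>. f x \<theta> * g x \<theta>) (\<lambda>_. l x * g x \<theta>\<^sub>0) (interior \<Theta>)" for x
      by (rule C1_has_distributional_derivative_on[OF line])
        (simp_all add: fg subsetD[OF interior_subset])
    show "integrable \<mu> (\<lambda>x. \<bar>l x * g x \<theta>\<^sub>0\<bar>)"
      using l(2) by (auto simp: has_bochner_integral_iff)
    show "(\<lambda>\<theta>. f x \<theta> * g x \<theta>) differentiable at \<theta>\<^sub>0" for x
      using deriv real_differentiable_def by blast
  qed (use fm \<theta>\<^sub>0 interior_subset in auto)
qed

theorem theorem2p1:
  fixes \<mu> :: "real measure" and \<Theta> :: "real set" and \<theta>\<^sub>0 :: real
    and g :: "real \<Rightarrow> real \<Rightarrow> real"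
    and M :: "'a measure" and X :: "'a \<Rightarrow> real"
    and N :: "'b measure" and Z :: "real \<Rightarrow> 'b \<Rightarrow> real"
  assumes "sigma_finite_measure \<mu>" and "sets \<mu> = sets borel"
    and "\<theta>\<^sub>0 \<in> interior \<Theta>"
    and "g \<in> dominated_densities \<mu> \<Theta> \<theta>\<^sub>0"
    and "prob_space N"
    and "\<And>\<theta>. \<theta> \<in> \<Theta> \<Longrightarrow> distributed N \<mu> (Z \<theta>) (\<lambda>x. ennreal (g x \<theta>))"
    and "prob_space M" and "X \<in> borel_measurable M"
  shows "(distr M borel X = distr N borel (Z \<theta>\<^sub>0) \<longrightarrow>
           (\<forall>f\<in>stein_class \<mu> \<Theta> g \<theta>\<^sub>0.
              (AE x in \<mu>. x \<notin> density_support g \<theta>\<^sub>0 \<longrightarrow>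
                 ((\<lambda>\<theta>. f x \<theta> * g x \<theta>) has_real_derivative 0) (at \<theta>\<^sub>0)) \<longrightarrow>
              has_bochner_integral M (\<lambda>\<omega>. stein_operator \<theta>\<^sub>0 f g (X \<omega>)) 0)) \<and>
         (\<forall>S. (\<forall>\<theta>\<in>\<Theta>. density_support g \<theta> = S) \<and>
              (\<forall>f\<in>stein_class \<mu> \<Theta> g \<theta>\<^sub>0.
                 has_bochner_integral M (\<lambda>\<omega>. stein_operator \<theta>\<^sub>0 f g (X \<omega>)) 0) \<and>
              measure M {\<omega> \<in> space M. X \<omega> \<in> S} > 0 \<longrightarrow>
              distr (uniform_measure M {\<omega> \<in> space M. X \<omega> \<in> S}) borel X = distr N borel (Z \<theta>\<^sub>0))"
proof -
  interpret M: prob_space M by fact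
  interpret N: prob_space N by fact
  note [measurable] = \<open>X \<in> borel_measurable M\<close>
  have T: "\<theta>\<^sub>0 \<in> \<Theta>"
    using \<open>\<theta>\<^sub>0 \<in> interior \<Theta>\<close> interior_subset by blast
  have g: "g \<in> parametric_densities \<mu> \<Theta>"
    using assms(4) by (simp add: dominated_densities_def)
  have gm[measurable]: "(\<lambda>x. g x \<theta>\<^sub>0) \<in> borel_measurable borel"
    and gnn: "\<And>x. 0 \<le> g x \<theta>\<^sub>0" and g1: "has_bochner_integral \<mu> (\<lambda>x. g x \<theta>\<^sub>0) 1"
    using g T by (auto simp: parametric_densities_def intro: measurable_at_parameter)
  note [measurable_cong] = \<open>sets \<mu> = sets borel\<close>
  have Z: "distr N borel (Z \<theta>\<^sub>0) = density \<mu> (\<lambda>x. ennreal (g x \<theta>\<^sub>0))"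
    using distributed_distr_eq_density[OF assms(6)[OF T]] distr_cong[OF refl \<open>sets \<mu> = sets borel\<close>]
    by metis
  show ?thesis
  proof (intro conjI impI allI ballI)
    fix f
    assume X: "distr M borel X = distr N borel (Z \<theta>\<^sub>0)" and f: "f \<in> stein_class \<mu> \<Theta> g \<theta>\<^sub>0"
      and off: "AE x in \<mu>. x \<notin> density_support g \<theta>\<^sub>0 \<longrightarrow>
                 ((\<lambda>\<theta>. f x \<theta> * g x \<theta>) has_real_derivative 0) (at \<theta>\<^sub>0)"
    let ?T = "stein_operator \<theta>\<^sub>0 f g"
    have [measurable]: "?T \<in> borel_measurable borel"
      using g f assms(3) by (rule stein_operator_measurable)
    have *: "has_bochner_integral \<mu> (\<lambda>x. g x \<theta>\<^sub>0 * ?T x) 0"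
      by (rule stein_identity[OF assms(1,2) g f assms(3) off])
    then have "integrable (distr M borel X) ?T" "integral\<^sup>L (distr M borel X) ?T = 0"
      unfolding X Z using gnn
      by (simp_all add: integrable_density integral_density has_bochner_integral_iff)
    then show "has_bochner_integral M (\<lambda>\<omega>. ?T (X \<omega>)) 0"
      by (simp add: integrable_distr_eq integral_distr has_bochner_integral_iff)
  next
    fix S
    assume "(\<forall>\<theta>\<in>\<Theta>. density_support g \<theta> = S) \<and>
      (\<forall>f\<in>stein_class \<mu> \<Theta> g \<theta>\<^sub>0.
        has_bochner_integral M (\<lambda>\<omega>. stein_operator \<theta>\<^sub>0 f g (X \<omega>)) 0) \<and>
      measure M {\<omega> \<in> space M. X \<omega> \<in> S} > 0"
    then have S: "\<And>\<theta>. \<theta> \<in> \<Theta> \<Longrightarrow> density_support g \<theta> = S"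
      and stein: "\<And>f. f \<in> stein_class \<mu> \<Theta> g \<theta>\<^sub>0 \<Longrightarrow>
        has_bochner_integral M (\<lambda>\<omega>. stein_operator \<theta>\<^sub>0 f g (X \<omega>)) 0"
      and pos: "measure M {\<omega> \<in> space M. X \<omega> \<in> S} > 0"
      by auto
    have [measurable]: "S \<in> sets borel"
      using density_support_measurable[OF g T] S[OF T] by simp
    define E where "E = {\<omega> \<in> space M. X \<omega> \<in> S}"
    have E[measurable]: "E \<in> sets M"
      unfolding E_def by measurable
    interpret Q: prob_space "uniform_measure M E"
      using pos by (intro prob_space_uniform_measure) (auto simp: E_def M.emeasure_eq_measure)
    show "distr (uniform_measure M E) borel X = distr N borel (Z \<theta>\<^sub>0)"
    proof (rule measure_eqI)
      fix A assume "A \<in> sets (distr (uniform_measure M E) borel X)"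
      then have A[measurable]: "A \<in> sets borel"
        by simp
      \<comment> \<open>\<open>p\<close> is the probability of \<open>A\<close> under \<open>g(\<cdot>; \<theta>\<^sub>0)\<close>, so that \<open>l\<close> is centred.\<close>
      define p where "p = (LINT x|\<mu>. indicator A x * g x \<theta>\<^sub>0)"
      have gA: "integrable \<mu> (\<lambda>x. indicator A x * g x \<theta>\<^sub>0)"
        using integrable_mult_indicator[of A \<mu> "\<lambda>x. g x \<theta>\<^sub>0"] g1 A assms(2)
        by (auto simp: has_bochner_integral_iff)
      define l where "l x = indicator A x - p" for x
      have lm: "l \<in> borel_measurable borel"
        unfolding l_def by measurable
      have "has_bochner_integral \<mu> (\<lambda>x. indicator A x * g x \<theta>\<^sub>0 - p * g x \<theta>\<^sub>0) (p - p * 1)"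
        using gA by (intro has_bochner_integral_diff has_bochner_integral_mult_right g1)
          (simp add: has_bochner_integral_iff p_def)
      then have l0: "has_bochner_integral \<mu> (\<lambda>x. l x * g x \<theta>\<^sub>0) 0"
        by (simp add: l_def left_diff_distrib)
      have eqS: "\<And>\<theta>. \<theta> \<in> \<Theta> \<Longrightarrow> density_support g \<theta> = density_support g \<theta>\<^sub>0"
        using S T by simp
      note lin = linear_perturbation_in_stein_class[OF assms(2) g assms(3) eqS lm l0]
      have "has_bochner_integral M (\<lambda>\<omega>. if X \<omega> \<in> S then l (X \<omega>) else 0) 0"
        using stein[OF lin(1)] by (simp add: lin(2) S[OF T])
      then have "(LINT \<omega>|M. (if X \<omega> \<in> S then l (X \<omega>) else 0)) = 0"
        by (simp add: has_bochner_integral_iff)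
      also have "(LINT \<omega>|M. (if X \<omega> \<in> S then l (X \<omega>) else 0))
          = (LINT \<omega>|M. indicator (E \<inter> (X -` A \<inter> space M)) \<omega> - p * indicator E \<omega>)"
        by (intro Bochner_Integration.integral_cong) (auto simp: l_def E_def indicator_def)
      also have "\<dots> = measure M (E \<inter> (X -` A \<inter> space M)) - p * measure M E"
        by (subst Bochner_Integration.integral_diff) (auto simp: M.emeasure_eq_measure)
      finally have "measure M (E \<inter> (X -` A \<inter> space M)) / measure M E = p"
        using pos by (simp add: E_def)
      then have "emeasure (distr (uniform_measure M E) borel X) A = ennreal p"
        using pos by (simp add: emeasure_distr M.emeasure_eq_measure
            divide_ennreal E_def[symmetric])
      also have "\<dots> = (\<integral>\<^sup>+x. ennreal (indicator A x * g x \<theta>\<^sub>0) \<partial>\<mu>)"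
        unfolding p_def using gA gnn by (intro nn_integral_eq_integral[symmetric]) auto
      also have "\<dots> = emeasure (distr N borel (Z \<theta>\<^sub>0)) A"
        unfolding Z using A assms(2) gnn
        by (subst emeasure_density) (auto intro!: nn_integral_cong simp: indicator_def)
      finally show "emeasure (distr (uniform_measure M E) borel X) A
        = emeasure (distr N borel (Z \<theta>\<^sub>0)) A" .
    qed simp
  qed
qed

end
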